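(* Let $(X,\mathcal{B})$ be a ball space. The topology associated with $(X,\mathcal{B})$ is compact if and only if $(X,\mathcal{B})$ is an $\mathbf{S}_1^c$ ball space.
   Context: A ball space $(X,\mathcal{B})$ consists of a nonempty set $X$ and a nonempty family $\mathcal{B}$ of nonempty subsets of $X$, called balls. A centered system of balls is a nonempty collection of balls such that the intersection of any finite number of balls in the collection is nonempty. $(X,\mathcal{B})$ is an $\mathbf{S}_1^c$ ball space if the intersection of each centered system of balls is nonempty. The topology associated with $(X,\mathcal{B})$: let $\mathcal{B}'$ be obtained from $\mathcal{B}$ by first closing under finite unions (forming all unions of finitely many, at least one, balls in $\mathcal{B}$) and then closing under arbitrary nonempty intersections (forming all nonempty sets which are intersections of nonempty collections of such finite unions). Then $\mathcal{B}'\cup\{X,\emptyset\}$ is the collection of closed sets of a topology on $X$, called the topology associated with $(X,\mathcal{B})$. "Compact" means that every open cover has a finite subcover; the Hausdorff property is not assumed. *)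

theory Defs
  imports "HOL-Analysis.Analysis"
begin

definition ball_space :: "'a set \<Rightarrow> 'a set set \<Rightarrow> bool" where
  "ball_space X \<B> \<longleftrightarrow> X \<noteq> {} \<and> \<B> \<noteq> {} \<and> (\<forall>B\<in>\<B>. B \<noteq> {} \<and> B \<subseteq> X)"

definition centered_system :: "'a set set \<Rightarrow> 'a set set \<Rightarrow> bool" where
  "centered_system \<B> \<C> \<longleftrightarrow>
     \<C> \<noteq> {} \<and> \<C> \<subseteq> \<B> \<and> (\<forall>\<F>. \<F> \<subseteq> \<C> \<and> finite \<F> \<and> \<F> \<noteq> {} \<longrightarrow> \<Inter>\<F> \<noteq> {})"

definition S1c_ball_space :: "'a set \<Rightarrow> 'a set set \<Rightarrow> bool" where
  "S1c_ball_space X \<B> \<longleftrightarrow>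
     ball_space X \<B> \<and> (\<forall>\<C>. centered_system \<B> \<C> \<longrightarrow> \<Inter>\<C> \<noteq> {})"

definition finite_unions :: "'a set set \<Rightarrow> 'a set set" where
  "finite_unions \<B> = {\<Union>\<F> | \<F>. \<F> \<subseteq> \<B> \<and> finite \<F> \<and> \<F> \<noteq> {}}"

definition nonempty_intersections :: "'a set set \<Rightarrow> 'a set set" where
  "nonempty_intersections \<B> = {\<Inter>\<C> | \<C>. \<C> \<subseteq> \<B> \<and> \<C> \<noteq> {} \<and> \<Inter>\<C> \<noteq> {}}"

definition ball_closed_sets :: "'a set \<Rightarrow> 'a set set \<Rightarrow> 'a set set" where
  "ball_closed_sets X \<B> = nonempty_intersections (finite_unions \<B>) \<union> {X, {}}"

definition ball_topology :: "'a set \<Rightarrow> 'a set set \<Rightarrow> 'a topology" where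
  "ball_topology X \<B> = topology (\<lambda>U. U \<subseteq> X \<and> X - U \<in> ball_closed_sets X \<B>)"

text \<open>The function \<open>topology\<close> is only meaningful on predicates that satisfy \<open>istopology\<close>;
  the following facts discharge this and show that the closed sets of \<open>ball_topology\<close> are
  exactly the intended ones.\<close>

lemma finite_unions_Un:
  assumes "A \<in> finite_unions \<B>" "B \<in> finite_unions \<B>"
  shows "A \<union> B \<in> finite_unions \<B>"
proof -
  obtain F G where "A = \<Union>F" "F \<subseteq> \<B>" "finite F" "F \<noteq> {}"
    and "B = \<Union>G" "G \<subseteq> \<B>" "finite G"
    using assms by (auto simp: finite_unions_def)
  then show ?thesis
    unfolding finite_unions_def by (intro CollectI exI[of _ "F \<union> G"]) auto
qed

lemma finite_unions_subset:
  assumes "ball_space X \<B>" "A \<in> finite_unions \<B>"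
  shows "A \<subseteq> X"
proof -
  obtain F where F: "A = \<Union>F" "F \<subseteq> \<B>"
    using assms(2) by (auto simp: finite_unions_def)
  show ?thesis
    unfolding F(1) by (rule Union_least) (use F(2) assms(1) in \<open>auto simp: ball_space_def\<close>)
qed

lemma ball_closed_sets_cases:
  assumes "A \<in> ball_closed_sets X \<B>"
  obtains "A = X" | "A = {}"
  | C where "A = \<Inter>C" "C \<subseteq> finite_unions \<B>" "C \<noteq> {}" "A \<noteq> {}"
proof -
  consider "A = X" | "A = {}" | "A \<in> nonempty_intersections (finite_unions \<B>)"
    using assms by (auto simp: ball_closed_sets_def)
  then show thesis
  proof cases
    case 3
    then obtain C where "A = \<Inter>C" "C \<subseteq> finite_unions \<B>" "C \<noteq> {}" "\<Inter>C \<noteq> {}"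
      unfolding nonempty_intersections_def mem_Collect_eq by (elim exE conjE)
    then show thesis
      using that(3)[of C] by simp
  qed (use that in simp_all)
qed

lemma ball_closed_sets_subset:
  assumes bs: "ball_space X \<B>" and A: "A \<in> ball_closed_sets X \<B>"
  shows "A \<subseteq> X"
  using A
proof (cases rule: ball_closed_sets_cases)
  case (3 C)
  then obtain c where "c \<in> C" by (meson all_not_in_conv)
  then have "\<Inter>C \<subseteq> c" "c \<in> finite_unions \<B>"
    using 3(2) by (auto intro: Inter_lower)
  then show ?thesis
    using finite_unions_subset[OF bs, of c] 3(1) by (metis order_trans)
qed simp_all

lemma ball_closed_sets_Un:
  assumes bs: "ball_space X \<B>"
    and A: "A \<in> ball_closed_sets X \<B>" and B: "B \<in> ball_closed_sets X \<B>"
  shows "A \<union> B \<in> ball_closed_sets X \<B>"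
proof (cases "A \<in> {X, {}} \<or> B \<in> {X, {}}")
  case True
  with ball_closed_sets_subset[OF bs A] ball_closed_sets_subset[OF bs B]
  consider "A \<union> B = X" | "A \<union> B = A" | "A \<union> B = B"
    by blast
  then show ?thesis
    using A B by cases (simp_all add: ball_closed_sets_def)
next
  case False
  from A obtain C where C: "A = \<Inter>C" "C \<subseteq> finite_unions \<B>" "C \<noteq> {}"
    by (cases rule: ball_closed_sets_cases) (use False in simp_all)
  from B obtain D where D: "B = \<Inter>D" "D \<subseteq> finite_unions \<B>" "D \<noteq> {}"
    by (cases rule: ball_closed_sets_cases) (use False in simp_all)
  let ?E = "(\<lambda>(c, d). c \<union> d) ` (C \<times> D)"
  have eq: "A \<union> B = \<Inter>?E"
    unfolding C(1) D(1) by auto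
  have sub: "?E \<subseteq> finite_unions \<B>"
    using C(2) D(2) by (auto intro: finite_unions_Un)
  have ne: "?E \<noteq> {}"
    using C(3) D(3) by simp
  have "A \<union> B \<noteq> {}"
    using False by simp
  then have "A \<union> B \<in> nonempty_intersections (finite_unions \<B>)"
    unfolding nonempty_intersections_def eq using sub ne
    by (intro CollectI exI[of _ ?E] conjI refl)
  then show ?thesis
    unfolding ball_closed_sets_def by (rule UnI1)
qed

lemma ball_closed_sets_Inter:
  assumes bs: "ball_space X \<B>" and K: "K \<subseteq> ball_closed_sets X \<B>" "K \<noteq> {}"
  shows "\<Inter>K \<in> ball_closed_sets X \<B>"
proof (cases "\<Inter>K = {} \<or> K = {X}")
  case True
  then show ?thesis
    by (auto simp: ball_closed_sets_def)
next
  case False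
  let ?K = "K - {X}"
  have "?K \<noteq> {}"
    using False K by blast
  have eq: "\<Inter>K = \<Inter>?K"
    using \<open>?K \<noteq> {}\<close> K ball_closed_sets_subset[OF bs] by blast
  have "\<exists>C. A = \<Inter>C \<and> C \<subseteq> finite_unions \<B> \<and> C \<noteq> {}" if "A \<in> ?K" for A
  proof -
    have "A \<noteq> {}" using that False by blast
    then have "A \<in> nonempty_intersections (finite_unions \<B>)"
      using that K by (auto simp: ball_closed_sets_def)
    then show ?thesis by (auto simp: nonempty_intersections_def)
  qed
  then have "\<forall>A\<in>?K. \<exists>C. A = \<Inter>C \<and> C \<subseteq> finite_unions \<B> \<and> C \<noteq> {}"
    by simp
  from bchoice[OF this] obtain C
    where C: "\<forall>A\<in>?K. A = \<Inter>(C A) \<and> C A \<subseteq> finite_unions \<B> \<and> C A \<noteq> {}"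
    by auto
  have "(\<lambda>A. \<Inter>(C A)) ` ?K = (\<lambda>A. A) ` ?K"
    by (rule image_cong[OF refl]) (use C in metis)
  then have "\<Inter>?K = (\<Inter>A\<in>?K. \<Inter>(C A))"
    by simp
  also have "\<dots> = \<Inter>(\<Union>A\<in>?K. C A)"
    by auto
  finally have "\<Inter>K = \<Inter>(\<Union>A\<in>?K. C A)"
    using eq by simp
  moreover have "(\<Union>A\<in>?K. C A) \<subseteq> finite_unions \<B>"
    by (rule UN_least) (use C in simp)
  moreover have "(\<Union>A\<in>?K. C A) \<noteq> {}"
    using C \<open>?K \<noteq> {}\<close> by (metis UN_I all_not_in_conv)
  moreover have "\<Inter>K \<noteq> {}"
    using False by simp
  ultimately have "\<Inter>K \<in> nonempty_intersections (finite_unions \<B>)"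
    unfolding nonempty_intersections_def by (intro CollectI exI[of _ "\<Union>A\<in>?K. C A"]) simp
  then show ?thesis
    unfolding ball_closed_sets_def by (rule UnI1)
qed

lemma istopology_ball_topology:
  assumes bs: "ball_space X \<B>"
  shows "istopology (\<lambda>U. U \<subseteq> X \<and> X - U \<in> ball_closed_sets X \<B>)"
  unfolding istopology_def
proof (intro conjI allI impI)
  fix S T
  assume S: "S \<subseteq> X \<and> X - S \<in> ball_closed_sets X \<B>"
    and T: "T \<subseteq> X \<and> X - T \<in> ball_closed_sets X \<B>"
  show "S \<inter> T \<subseteq> X" using S by blast
  have "X - S \<inter> T = (X - S) \<union> (X - T)" by blast
  then show "X - S \<inter> T \<in> ball_closed_sets X \<B>"
    using ball_closed_sets_Un[OF bs] S T by simp
next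
  fix K :: "'a set set"
  assume K: "\<forall>S\<in>K. S \<subseteq> X \<and> X - S \<in> ball_closed_sets X \<B>"
  show "\<Union>K \<subseteq> X" using K by blast
  show "X - \<Union>K \<in> ball_closed_sets X \<B>"
  proof (cases "K = {}")
    case True
    then show ?thesis by (simp add: ball_closed_sets_def)
  next
    case False
    then have "X - \<Union>K = \<Inter>((\<lambda>S. X - S) ` K)" by blast
    moreover have "(\<lambda>S. X - S) ` K \<subseteq> ball_closed_sets X \<B>" using K by blast
    ultimately show ?thesis using ball_closed_sets_Inter[OF bs] False by (metis image_is_empty)
  qed
qed

lemma openin_ball_topology:
  assumes "ball_space X \<B>"
  shows "openin (ball_topology X \<B>) U \<longleftrightarrow> U \<subseteq> X \<and> X - U \<in> ball_closed_sets X \<B>"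
  unfolding ball_topology_def
  by (simp add: topology_inverse'[OF istopology_ball_topology[OF assms]])

lemma topspace_ball_topology:
  assumes "ball_space X \<B>"
  shows "topspace (ball_topology X \<B>) = X"
proof -
  have "openin (ball_topology X \<B>) X"
    by (simp add: openin_ball_topology[OF assms] ball_closed_sets_def)
  then show ?thesis
    unfolding topspace_def using openin_ball_topology[OF assms] by blast
qed

lemma closedin_ball_topology:
  assumes "ball_space X \<B>"
  shows "closedin (ball_topology X \<B>) A \<longleftrightarrow> A \<in> ball_closed_sets X \<B>"
proof -
  have "X - (X - A) = A" if "A \<subseteq> X"
    using that by blast
  then show ?thesis
    unfolding closedin_def topspace_ball_topology[OF assms] openin_ball_topology[OF assms]
    using ball_closed_sets_subset[OF assms] by auto
qed

end

theory Submission
  imports Defs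
begin

text \<open>
  The balls are closed in the associated topology, and every closed set is built from balls by
  finite unions and arbitrary intersections; so the balls form a subbase of closed sets.
  Compactness gives the finite intersection property for arbitrary families of closed sets, in
  particular for centered systems of balls.  Conversely, the \<open>S\<^sub>1\<^sup>c\<close> property says exactly that
  every cover by complements of balls has a finite subcover, and by the Alexander subbase
  theorem it suffices to consider covers by members of a subbase.  The lemma
  \<open>ball_topology_subbase\<close> is the link between the two descriptions of the topology.
\<close>

lemma closedin_ball:
  assumes "ball_space X \<B>" "B \<in> \<B>"
  shows "closedin (ball_topology X \<B>) B"
proof -
  have "B \<in> finite_unions \<B>"
    using assms(2) unfolding finite_unions_def by (intro CollectI exI[of _ "{B}"]) auto
  moreover have "B \<noteq> {}"
    using assms by (auto simp: ball_space_def)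
  ultimately have "B \<in> nonempty_intersections (finite_unions \<B>)"
    unfolding nonempty_intersections_def by (intro CollectI exI[of _ "{B}"]) auto
  then show ?thesis
    by (simp add: closedin_ball_topology[OF assms(1)] ball_closed_sets_def)
qed

text \<open>
  An open set other than \<open>X\<close> and \<open>{}\<close> is the complement of an intersection of finite unions of
  balls, hence by De Morgan a union of finite intersections of complements of balls.  The set
  \<open>X\<close> is inserted into the subbase because the balls may have a common point, in which case
  their complements do not cover \<open>X\<close>, whereas the subbase theorem is about subbases that do.
\<close>

lemma ball_topology_subbase:
  assumes bs: "ball_space X \<B>"
  shows "topology (arbitrary union_of
           (finite intersection_of (\<lambda>S. S \<in> insert X ((\<lambda>B. X - B) ` \<B>)) relative_to X))
         = ball_topology X \<B>" (is "?T = _")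
  unfolding topology_eq
proof (intro allI iffI)
  fix U
  assume "openin ?T U"
  moreover have "openin (ball_topology X \<B>) S" if "S \<in> insert X ((\<lambda>B. X - B) ` \<B>)" for S
    using that closedin_ball[OF bs] topspace_ball_topology[OF bs]
    by (auto simp: closedin_def) (metis openin_topspace)
  moreover have "openin (ball_topology X \<B>) X"
    using topspace_ball_topology[OF bs] by (metis openin_topspace)
  ultimately show "openin (ball_topology X \<B>) U"
    by (metis (no_types, lifting) minimal_topology_subbase)
next
  fix U
  assume "openin (ball_topology X \<B>) U"
  then have U: "U \<subseteq> X" "X - U \<in> ball_closed_sets X \<B>"
    by (simp_all add: openin_ball_topology[OF bs])
  have top: "topspace ?T = X"
    by (rule topspace_subbase)
  have compl_ball: "openin ?T (X - B)" if "B \<in> \<B>" for B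
  proof -
    have "(finite intersection_of (\<lambda>S. S \<in> insert X ((\<lambda>B. X - B) ` \<B>)) relative_to X) (X - B)"
      using that by (intro relative_to_subset_inc finite_intersection_of_inc) auto
    then show ?thesis
      by (simp add: openin_subbase arbitrary_union_of_inc)
  qed
  have compl_union: "openin ?T (X - c)" if "c \<in> finite_unions \<B>" for c
  proof -
    obtain F where F: "c = \<Union>F" "F \<subseteq> \<B>" "finite F" "F \<noteq> {}"
      using \<open>c \<in> finite_unions \<B>\<close>
      unfolding finite_unions_def mem_Collect_eq by (elim exE conjE)
    have "openin ?T (\<Inter>B\<in>F. X - B)"
      by (rule openin_INT2[OF F(3,4)]) (rule compl_ball, rule subsetD[OF F(2)])
    also have "(\<Inter>B\<in>F. X - B) = X - c"
      unfolding F(1) using F(4) by blast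
    finally show ?thesis .
  qed
  show "openin ?T U"
    using U(2)
  proof (cases rule: ball_closed_sets_cases)
    case 1
    then have "U = {}" using U(1) by blast
    then show ?thesis by simp
  next
    case 2
    then have "U = X" using U(1) by blast
    then show ?thesis using top by (metis openin_topspace)
  next
    case (3 C)
    have "U = X - \<Inter>C"
      using U(1) 3(1) by blast
    also have "\<dots> = \<Union>((\<lambda>c. X - c) ` C)"
      by blast
    finally have "U = \<Union>((\<lambda>c. X - c) ` C)" .
    moreover have "openin ?T (\<Union>((\<lambda>c. X - c) ` C))"
      by (rule openin_Union) (use 3(2) compl_union in blast)
    ultimately show ?thesis by (simp only:)
  qed
qed

lemma finite_subcover_of_ball_complements:
  assumes S1c: "S1c_ball_space X \<B>"
    and D: "\<D> \<subseteq> \<B>" "X \<subseteq> (\<Union>B\<in>\<D>. X - B)"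
  obtains \<F> where "finite \<F>" "\<F> \<subseteq> \<D>" "X \<subseteq> (\<Union>B\<in>\<F>. X - B)"
proof -
  have bs: "X \<noteq> {}" "\<And>B. B \<in> \<B> \<Longrightarrow> B \<subseteq> X"
    using S1c by (auto simp: S1c_ball_space_def ball_space_def)
  (* Nonemptiness matters: centered systems are nonempty, and the intersection of the empty
     family would be the whole type. *)
  have "\<D> \<noteq> {}"
    using D(2) bs(1) by auto
  moreover have "\<Inter>\<D> = {}"
    using D bs(2) \<open>\<D> \<noteq> {}\<close> by blast
  moreover have "\<not> centered_system \<B> \<D>"
    using S1c \<open>\<Inter>\<D> = {}\<close> by (auto simp only: S1c_ball_space_def)
  ultimately have "\<exists>\<F>. \<F> \<subseteq> \<D> \<and> finite \<F> \<and> \<F> \<noteq> {} \<and> \<Inter>\<F> = {}"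
    using D(1) by (simp add: centered_system_def)
  then obtain \<F> where F: "\<F> \<subseteq> \<D>" "finite \<F>" "\<Inter>\<F> = {}"
    by auto
  have "X \<subseteq> (\<Union>B\<in>\<F>. X - B)"
    using F(3) by blast
  with F that show thesis by blast
qed

lemma compact_space_if_S1c:
  assumes S1c: "S1c_ball_space X \<B>"
  shows "compact_space (ball_topology X \<B>)"
proof (rule Alexander_subbase_alt)
  have bs: "ball_space X \<B>"
    using S1c by (simp add: S1c_ball_space_def)
  let ?S = "insert X ((\<lambda>B. X - B) ` \<B>)"
  show "X \<subseteq> \<Union>?S" by simp
  show "topology (arbitrary union_of (finite intersection_of (\<lambda>S. S \<in> ?S) relative_to X))
        = ball_topology X \<B>"
    by (rule ball_topology_subbase[OF bs])
  fix \<C>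
  assume C: "\<C> \<subseteq> ?S" "X \<subseteq> \<Union>\<C>"
  show "\<exists>\<C>'. finite \<C>' \<and> \<C>' \<subseteq> \<C> \<and> X \<subseteq> \<Union>\<C>'"
  proof (cases "X \<in> \<C>")
    case True
    then show ?thesis by (intro exI[of _ "{X}"]) simp
  next
    case False
    then have "\<C> \<subseteq> (\<lambda>B. X - B) ` \<B>"
      using C(1) by blast
    then obtain \<D> where D: "\<D> \<subseteq> \<B>" "\<C> = (\<lambda>B. X - B) ` \<D>"
      by (auto simp: subset_image_iff)
    with C(2) obtain \<F> where "finite \<F>" "\<F> \<subseteq> \<D>" "X \<subseteq> (\<Union>B\<in>\<F>. X - B)"
      using finite_subcover_of_ball_complements[OF S1c] by metis
    then show ?thesis
      using D(2) by (intro exI[of _ "(\<lambda>B. X - B) ` \<F>"]) auto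
  qed
qed

lemma S1c_if_compact_space:
  assumes bs: "ball_space X \<B>" and compact: "compact_space (ball_topology X \<B>)"
  shows "S1c_ball_space X \<B>"
  unfolding S1c_ball_space_def
proof (intro conjI allI impI)
  show "ball_space X \<B>" by (rule bs)
  fix \<C>
  assume C: "centered_system \<B> \<C>"
  have "closedin (ball_topology X \<B>) B" if "B \<in> \<C>" for B
    using that C closedin_ball[OF bs] by (auto simp: centered_system_def)
  moreover have "\<Inter>\<F> \<noteq> {}" if "finite \<F>" "\<F> \<subseteq> \<C>" for \<F>
    using that C by (cases "\<F> = {}") (auto simp: centered_system_def)
  ultimately show "\<Inter>\<C> \<noteq> {}"
    using compact unfolding compact_space_fip by simp
qed

theorem theorem7p13:
  fixes X :: "'a set" and \<B> :: "'a set set"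
  assumes "ball_space X \<B>"
  shows "compact_space (ball_topology X \<B>) \<longleftrightarrow> S1c_ball_space X \<B>"
  using S1c_if_compact_space[OF assms] compact_space_if_S1c by blast

end
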